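(* Let $d\geq5$ and $r>0$. There exists $j_0$ large enough such that $$\mathrm{P}\big(\mathrm{cap}(W^{0,r}_{[0,t]})\geq j\,t\,r^{d-4}\big)\leq e^{-cjt},\qquad j\geq j_0,$$ where $c\in(0,\infty)$ is a constant possibly depending on the dimension $d$.
   Context: $t>0$ denotes time. $B^0$ is a standard Brownian motion in $\mathbb{R}^d$ started at $0$ under $\mathrm{P}$, and $W^{0,r}_{[0,t]}=\bigcup_{0\le s\le t}\mathcal{B}(B^0_s,r)$ is the Wiener sausage of radius $r$ up to time $t$, where $\mathcal{B}(z,r)$ is the open Euclidean ball with center $z$ and radius $r$. For a bounded Borel set $A\subseteq\mathbb{R}^d$, the Newtonian capacity is $\mathrm{cap}(A)=\big[\inf_\nu\int_A\int_A G(x,y)\,\nu(\mathrm{d}x)\,\nu(\mathrm{d}y)\big]^{-1}$, the infimum being over all probability measures $\nu$ on $A$, with $G(x,y)=\frac{\Gamma(d/2-1)}{2\pi^{d/2}\|x-y\|^{d-2}}$. *)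

theory Defs
  imports "HOL-Probability.Probability"
begin

locale standard_brownian_motion = prob_space M
  for M :: "'w measure" +
  fixes B :: "real \<Rightarrow> 'w \<Rightarrow> 'a::euclidean_space"
  assumes measurable_BM: "0 \<le> t \<Longrightarrow> random_variable borel (B t)"
    and start: "AE \<omega> in M. B 0 \<omega> = 0"
    and continuous_paths: "\<omega> \<in> space M \<Longrightarrow> continuous_on {0..} (\<lambda>t. B t \<omega>)"
    and gaussian_increments:
      "0 \<le> s \<Longrightarrow> s < t \<Longrightarrow>
        distributed M lborel (\<lambda>\<omega>. B t \<omega> - B s \<omega>)
          (\<lambda>x. ennreal (\<Prod>b\<in>Basis. normal_density 0 (sqrt (t - s)) (x \<bullet> b)))"
    and independent_increments:
      "\<And>(n::nat) (\<tau>::nat \<Rightarrow> real). 0 \<le> \<tau> 0 \<Longrightarrow> (\<And>i. i < n \<Longrightarrow> \<tau> i < \<tau> (Suc i)) \<Longrightarrow>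
        indep_vars (\<lambda>_. borel) (\<lambda>i \<omega>. B (\<tau> (Suc i)) \<omega> - B (\<tau> i) \<omega>) {..<n}"

definition wiener_sausage :: "real \<Rightarrow> real \<Rightarrow> (real \<Rightarrow> 'a::metric_space) \<Rightarrow> 'a set"
  where "wiener_sausage r t w = (\<Union>s\<in>{0..t}. ball (w s) r)"

text \<open>The Green function of Brownian motion in dimension \<open>d \<ge> 3\<close>. It is \<open>\<infinity>\<close> on the diagonal, which
  is why the division is that of \<^typ>\<open>ennreal\<close> (where \<open>a / 0 = \<infinity>\<close> for \<open>a > 0\<close>) and not that of
  \<^typ>\<open>real\<close>: otherwise measures with atoms would have finite energy.\<close>

definition green :: "'a::euclidean_space \<Rightarrow> 'a \<Rightarrow> ennreal"
  where "green x y =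
    ennreal (Gamma (real DIM('a) / 2 - 1)) /
    ennreal (2 * pi powr (real DIM('a) / 2) * norm (x - y) ^ (DIM('a) - 2))"

definition energy :: "'a::euclidean_space set \<Rightarrow> 'a measure \<Rightarrow> ennreal"
  where "energy A \<nu> = (\<integral>\<^sup>+x\<in>A. (\<integral>\<^sup>+y\<in>A. green x y \<partial>\<nu>) \<partial>\<nu>)"

text \<open>Probability measures on a Borel set \<open>A\<close> are represented as Borel probability measures on the
  whole space that give mass 1 to \<open>A\<close>. If there is none, or all have infinite energy, the infimum is
  \<open>\<infinity>\<close> and the capacity is 0.\<close>

definition prob_measures_on :: "'a::euclidean_space set \<Rightarrow> 'a measure set"
  where "prob_measures_on A = {\<nu>. prob_space \<nu> \<and> sets \<nu> = sets borel \<and> emeasure \<nu> A = 1}"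

definition newtonian_capacity :: "'a::euclidean_space set \<Rightarrow> ennreal"
  where "newtonian_capacity A = inverse (INF \<nu>\<in>prob_measures_on A. energy A \<nu>)"

end

theory Submission
  imports Defs "HOL-Real_Asymp.Real_Asymp"
begin

text \<open>
  If \<open>A\<close> is covered by \<open>n\<close> balls of radius \<open>R\<close>, cutting a probability measure on \<open>A\<close> into the pieces
  inside these balls and using the Cauchy-Schwarz inequality shows that its energy is at least
  \<open>const / (n R^(d-2))\<close>. So \<open>cap A \<le> const n R^(d-2)\<close>, and it suffices to bound the number of balls of
  radius of order \<open>r\<close> needed to cover the path.

  Sample the path at times \<open>i t / m\<close> and cover the samples greedily, opening a new ball whenever the
  displacement \<open>x\<close> from the current centre has \<open>f x \<ge> K\<close>, where \<open>f x\<close> is the mean of \<open>cosh (\<theta> x_b)\<close>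
  over the coordinates. As \<open>f\<close> is an exponential eigenfunction of the Gaussian kernel and \<open>f 0 = 1\<close>,
  the process \<open>exp (- \<theta>^2 s / 2) K^N f x\<close>, with \<open>N\<close> the number of new balls, is a
  supermartingale, whence \<open>E K^N \<le> exp (\<theta>^2 t / 2)\<close> uniformly in the mesh. By uniform continuity,
  slightly larger balls cover the whole path once the mesh is fine enough. Since \<open>\<theta>\<close>, and with it
  \<open>K\<close>, may be as large as we please (depending on \<open>r\<close>), Markov's inequality yields the
  rate \<open>c = 1\<close>.
\<close>

section \<open>Capacity of sets covered by balls\<close>

lemma sum_measure_cover_eq:
  fixes n :: nat
  assumes "prob_space \<nu>" "\<And>i. i < n \<Longrightarrow> D i \<in> sets \<nu>" "disjoint_family_on D {..<n}"
    "emeasure \<nu> (\<Union>i<n. D i) = 1"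
  shows "(\<Sum>i<n. measure \<nu> (D i)) = 1"
proof -
  interpret prob_space \<nu> by fact
  have "measure \<nu> (\<Union>i<n. D i) = (\<Sum>i<n. measure \<nu> (D i))"
    using assms by (intro finite_measure_finite_Union finite_lessThan) auto
  with assms(4) show ?thesis
    by (simp add: measure_def)
qed

lemma inverse_ennreal_antimono: "a \<le> b \<Longrightarrow> inverse b \<le> inverse (a::ennreal)"
  including ennreal.lifting by transfer (rule ereal_inverse_antimono)

text \<open>Only pairs of points in a common cell are kept. They are closer than
  \<open>2 * R\<close>, so a cell of mass \<open>p i\<close> contributes at least
  \<open>g * p i * p i\<close>, and the squared masses add up to at least
  \<open>1 / n\<close>.\<close>

lemma energy_ge_of_cover:
  fixes A :: "'a::euclidean_space set" and g :: real
  assumes \<nu>: "\<nu> \<in> prob_measures_on A"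
    and cover: "A \<subseteq> (\<Union>i<n. ball (c i) R)"
    and g: "0 \<le> g" "\<And>x y::'a. dist x y < 2 * R \<Longrightarrow> ennreal g \<le> green x y"
  shows "ennreal (g / real n) \<le> energy A \<nu>"
proof -
  interpret prob_space \<nu> using \<nu> by (simp add: prob_measures_on_def)
  have sets[simp]: "sets \<nu> = sets borel" and A1: "emeasure \<nu> A = 1"
    using \<nu> by (auto simp: prob_measures_on_def)
  have A[measurable]: "A \<in> sets \<nu>"
    using A1 emeasure_notin_sets by fastforce
  \<comment> \<open>Each point is assigned to the first ball containing it, which turns the cover
    into a partition of \<open>A\<close>.\<close>
  define D where "D i = {x \<in> A. x \<in> ball (c i) R \<and> (\<forall>l<i. x \<notin> ball (c l) R)}" for i
  have D_eq: "D i = A \<inter> ball (c i) R - (\<Union>l<i. ball (c l) R)" for i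
    by (auto simp: D_def)
  have D[measurable]: "D i \<in> sets \<nu>" for i
    unfolding D_eq using A by auto
  have disj: "disjoint_family_on D {..<n}"
    unfolding disjoint_family_on_def D_def by (auto, metis linorder_neqE_nat mem_ball)
  have UN: "(\<Union>i<n. D i) = A"
  proof (intro equalityI subsetI)
    fix x assume x: "x \<in> A"
    with cover have ex: "\<exists>i. i < n \<and> x \<in> ball (c i) R" by blast
    define i where "i = (LEAST i. i < n \<and> x \<in> ball (c i) R)"
    have "i < n \<and> x \<in> ball (c i) R" unfolding i_def by (rule LeastI_ex[OF ex])
    moreover have "x \<notin> ball (c l) R" if "l < i" for l
      using not_less_Least[of l "\<lambda>i. i < n \<and> x \<in> ball (c i) R"] that calculation
      unfolding i_def[symmetric] by auto
    ultimately show "x \<in> (\<Union>i<n. D i)" using x by (auto simp: D_def)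
  qed (auto simp: D_def)
  define p where "p i = measure \<nu> (D i)" for i
  have p0: "0 \<le> p i" for i by (simp add: p_def)
  have psum: "(\<Sum>i<n. p i) = 1"
    unfolding p_def by (rule sum_measure_cover_eq) (use disj UN A1 prob_space_axioms D in \<open>auto simp del: sets\<close>)
  \<comment> \<open>Cauchy-Schwarz against the constant 1; as the masses sum to 1, this also
    excludes \<open>n = 0\<close>.\<close>
  have CS: "1 \<le> (\<Sum>i<n. (p i)\<^sup>2) * real n"
    using sum_squared_le_sum_of_squares[of p "{..<n}"] psum by simp
  then have n: "n > 0" by (cases n) auto
  \<comment> \<open>The inner integral dominates a step function: at a point of cell
    \<open>i\<close>, integrating over that cell alone already gives \<open>g * p i\<close>.\<close>
  have pw: "(\<Sum>i<n. ennreal (g * p i) * indicator (D i) x)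
      \<le> (\<integral>\<^sup>+y\<in>A. green x y \<partial>\<nu>) * indicator A x" for x
  proof (cases "x \<in> A")
    case True
    then obtain i where i: "i < n" "x \<in> D i" using UN by blast
    have other: "indicator (D l) x = (0::ennreal)" if "l < n" "l \<noteq> i" for l
      using disj that i by (auto simp: disjoint_family_on_def indicator_def)
    have "(\<Sum>i<n. ennreal (g * p i) * indicator (D i) x)
        = (\<Sum>l<n. if l = i then ennreal (g * p i) else 0)"
      by (intro sum.cong) (use i other in auto)
    also have "\<dots> = ennreal (g * p i)" using i by simp
    also have "\<dots> = (\<integral>\<^sup>+y. ennreal g * indicator (D i) y \<partial>\<nu>)"
      by (simp only: p_def ennreal_mult g measure_nonneg nn_integral_cmult_indicator[OF D] flip: emeasure_eq_measure)
    also have "\<dots> \<le> (\<integral>\<^sup>+y\<in>A. green x y \<partial>\<nu>)"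
    proof (intro nn_integral_mono)
      fix y
      show "ennreal g * indicator (D i) y \<le> green x y * indicator A y"
      proof (cases "y \<in> D i")
        case True
        have "dist x y < 2 * R"
          using True i dist_triangle_less_add[of x "c i" R y R] by (auto simp: D_def dist_commute)
        then show ?thesis using True g by (auto simp: D_def)
      qed simp
    qed
    finally show ?thesis using True by simp
  next
    case False
    then show ?thesis by (simp add: D_def)
  qed
  have "g / real n \<le> g * (\<Sum>i<n. (p i)\<^sup>2)"
    using mult_left_mono[OF CS g(1)] n by (simp add: field_simps)
  then have "ennreal (g / real n) \<le> ennreal (g * (\<Sum>i<n. (p i)\<^sup>2))"
    by (rule ennreal_leI)
  also have "\<dots> = (\<Sum>i<n. ennreal (g * p i * p i))"
    using g p0 by (subst sum_ennreal) (auto simp: sum_distrib_left power2_eq_square mult_ac)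
  also have "\<dots> = (\<Sum>i<n. ennreal (g * p i) * emeasure \<nu> (D i))"
    using g p0 by (intro sum.cong) (auto simp: emeasure_eq_measure p_def ennreal_mult)
  also have "\<dots> = (\<integral>\<^sup>+x. (\<Sum>i<n. ennreal (g * p i) * indicator (D i) x) \<partial>\<nu>)"
    by (subst nn_integral_sum) (auto simp: nn_integral_cmult_indicator[OF D] simp del: sets)
  also have "\<dots> \<le> energy A \<nu>"
    unfolding energy_def by (intro nn_integral_mono pw)
  finally show ?thesis .
qed

text \<open>The kernel decreases with the distance, and \<open>G\<close> is its constant factor;
  dimension at least 3 makes the argument of Gamma positive.\<close>

lemma green_lower_bound:
  assumes "DIM('a::euclidean_space) \<ge> 3"
  shows "\<exists>G>0. \<forall>\<rho>>0. \<forall>x y::'a. dist x y < \<rho> \<longrightarrow> ennreal (G / \<rho> ^ (DIM('a) - 2)) \<le> green x y"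
proof (intro exI conjI allI impI)
  let ?a = "Gamma (real DIM('a) / 2 - 1)" and ?p = "2 * pi powr (real DIM('a) / 2)"
  have a: "?a > 0" using assms by (intro Gamma_real_pos) simp
  then show "?a / ?p > 0" by simp
  fix \<rho> :: real and x y :: 'a assume \<rho>: "\<rho> > 0" and xy: "dist x y < \<rho>"
  show "ennreal (?a / ?p / \<rho> ^ (DIM('a) - 2)) \<le> green x y"
  proof (cases "x = y")
    case True
    \<comment> \<open>On the diagonal the denominator vanishes, the exponent being positive, so the
      kernel is infinite there.\<close>
    then show ?thesis using assms a by (simp add: green_def ennreal_divide_zero zero_power)
  next
    case False
    then have pos: "0 < ?p * norm (x - y) ^ (DIM('a) - 2)" using False by simp
    have "?a / ?p / \<rho> ^ (DIM('a) - 2) \<le> ?a / (?p * norm (x - y) ^ (DIM('a) - 2))"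
      unfolding divide_divide_eq_left using pos a xy
      by (intro divide_left_mono mult_left_mono power_mono mult_pos_pos zero_less_power \<rho>)
        (use False in \<open>auto simp: dist_norm\<close>)
    also have "ennreal \<dots> = green x y"
      unfolding green_def using pos a by (intro divide_ennreal[symmetric]) auto
    finally show ?thesis by (simp add: ennreal_leI)
  qed
qed

lemma capacity_cover_bound:
  assumes "DIM('a::euclidean_space) \<ge> 3"
  shows "\<exists>C>0. \<forall>(A::'a set) n c R. R > 0 \<longrightarrow> A \<subseteq> (\<Union>i<n. ball (c i) R) \<longrightarrow>
    newtonian_capacity A \<le> ennreal (real n * C * R ^ (DIM('a) - 2))"
proof -
  obtain G where G: "G > 0"
    "\<And>\<rho> x (y::'a). \<rho> > 0 \<Longrightarrow> dist x y < \<rho> \<Longrightarrow> ennreal (G / \<rho> ^ (DIM('a) - 2)) \<le> green x y"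
    using green_lower_bound[OF assms] by blast
  \<comment> \<open>Two points of a ball of radius \<open>R\<close> are closer than
    \<open>2 * R\<close>; the power of 2 comes from this doubling.\<close>
  let ?C = "2 ^ (DIM('a) - 2) / G"
  show ?thesis
  proof (intro exI[of _ ?C] conjI allI impI)
    show "?C > 0" using G by simp
    fix A :: "'a set" and n :: nat and c R assume R: "R > (0::real)" and A: "A \<subseteq> (\<Union>i<n. ball (c i) R)"
    have green: "ennreal (G / (2 * R) ^ (DIM('a) - 2)) \<le> green x y" if "dist x y < 2 * R" for x y :: 'a
      using G(2)[of "2 * R" x y] R that by simp
    show "newtonian_capacity A \<le> ennreal (real n * ?C * R ^ (DIM('a) - 2))"
    proof (cases "n = 0")
      case True
      \<comment> \<open>Without balls \<open>A\<close> is empty and carries no probability measure: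
        the infimum is infinite and the capacity 0.\<close>
      then have "prob_measures_on A = {}" using A by (auto simp: prob_measures_on_def)
      then show ?thesis by (simp add: newtonian_capacity_def)
    next
      case False
      let ?g = "G / (2 * R) ^ (DIM('a) - 2)"
      have g: "?g / real n > 0" using G R False by simp
      have "ennreal (?g / real n) \<le> (INF \<nu>\<in>prob_measures_on A. energy A \<nu>)"
        using R G(1) by (intro INF_greatest energy_ge_of_cover[OF _ A] green) auto
      then have "newtonian_capacity A \<le> inverse (ennreal (?g / real n))"
        unfolding newtonian_capacity_def by (simp add: inverse_ennreal_antimono)
      also have "\<dots> = ennreal (real n * ?C * R ^ (DIM('a) - 2))"
        using g by (subst inverse_ennreal) (auto simp: field_simps power_mult_distrib)
      finally show ?thesis .
    qed
  qed
qed
section \<open>Exponential moments of the greedy covering of a random walk\<close>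

text \<open>For the walk with increments \<open>x\<close>: the number of completed balls (translates of \<open>U\<close>) after \<open>k\<close>
  steps, and the displacement from the centre of the current one.\<close>

primrec greedy :: "'a::real_normed_vector set \<Rightarrow> (nat \<Rightarrow> 'a) \<Rightarrow> nat \<Rightarrow> nat \<times> 'a" where
  "greedy U x 0 = (0, 0)"
| "greedy U x (Suc k) =
    (if snd (greedy U x k) + x k \<in> U then (fst (greedy U x k), snd (greedy U x k) + x k)
     else (Suc (fst (greedy U x k)), 0))"

lemma greedy_cong:
  "(\<And>i. i < k \<Longrightarrow> x i = y i) \<Longrightarrow> greedy U x k = greedy U y k"
  by (induction k) auto

text \<open>Fixing \<open>n\<close> above \<open>k\<close> keeps the induction on one product space.
  Both components are treated together because the counter is updated according to the
  displacement.\<close>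

lemma measurable_greedy:
  fixes U :: "'a::euclidean_space set"
  assumes [measurable]: "U \<in> sets borel" and "k \<le> n"
  shows "(\<lambda>x. fst (greedy U x k)) \<in> measurable (\<Pi>\<^sub>M i\<in>{..<n}. borel) (count_space UNIV)
    \<and> (\<lambda>x. snd (greedy U x k)) \<in> borel_measurable (\<Pi>\<^sub>M i\<in>{..<n}. borel)"
  using assms(2)
proof (induction k)
  case 0
  then show ?case by simp
next
  case (Suc k)
  then have [measurable]:
    "(\<lambda>x. fst (greedy U x k)) \<in> measurable (\<Pi>\<^sub>M i\<in>{..<n}. borel) (count_space UNIV)"
    "(\<lambda>x. snd (greedy U x k)) \<in> borel_measurable (\<Pi>\<^sub>M i\<in>{..<n}. borel)"
    "(\<lambda>x. x k) \<in> borel_measurable (\<Pi>\<^sub>M i\<in>{..<n}. (borel :: 'a measure))"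
    by auto
  have "(\<lambda>x. if snd (greedy U x k) + x k \<in> U then fst (greedy U x k) else Suc (fst (greedy U x k)))
      \<in> measurable (\<Pi>\<^sub>M i\<in>{..<n}. borel) (count_space UNIV)"
    by measurable
  moreover have "(\<lambda>x. if snd (greedy U x k) + x k \<in> U then snd (greedy U x k) + x k else 0)
      \<in> borel_measurable (\<Pi>\<^sub>M i\<in>{..<n}. borel)"
    by measurable
  ultimately show ?case by (simp only: greedy.simps if_distrib fst_conv snd_conv)
qed

text \<open>The centres \<open>c\<close> are the positions at which balls are opened, starting with
  \<open>s 0\<close>; the invariant is that the displacement is measured from the latest one.
  Numbering starts at 0, so a counter value N stands for N + 1 balls.\<close>

lemma greedy_cover:
  fixes s :: "nat \<Rightarrow> 'a::real_normed_vector"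
  defines "x \<equiv> \<lambda>i. s (Suc i) - s i"
  assumes "0 \<in> U"
  shows "\<exists>c. s k - snd (greedy U x k) = c (fst (greedy U x k)) \<and>
    (\<forall>i\<le>k. \<exists>l\<le>fst (greedy U x k). s i - c l \<in> U)"
proof (induction k)
  case 0
  show ?case using assms by (intro exI[of _ "\<lambda>_. s 0"]) simp
next
  case (Suc k)
  let ?N = "fst (greedy U x k)" and ?d = "snd (greedy U x k)"
  from Suc obtain c where c: "s k - ?d = c ?N" "\<And>i. i \<le> k \<Longrightarrow> \<exists>l\<le>?N. s i - c l \<in> U" by blast
  have eq: "?d + x k = s (Suc k) - c ?N" using c(1) by (simp add: x_def algebra_simps)
  show ?case
  proof (cases "?d + x k \<in> U")
    case True
    then show ?thesis using c eq by (intro exI[of _ c]) (auto simp: le_Suc_eq)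
  next
    case False
    have "\<exists>l\<le>Suc ?N. s i - (c(Suc ?N := s (Suc k))) l \<in> U" if "i \<le> Suc k" for i
    proof (cases "i = Suc k")
      case True
      then show ?thesis using assms by (intro exI[of _ "Suc ?N"]) simp
    next
      case False
      then obtain l where "l \<le> ?N" "s i - c l \<in> U" using c(2)[of i] \<open>i \<le> Suc k\<close> by auto
      then show ?thesis by (intro exI[of _ l]) auto
    qed
    then show ?thesis using False by (intro exI[of _ "c(Suc ?N := s (Suc k))"]) auto
  qed
qed

lemma borel_measurable_greedy_weight:
  fixes f :: "'a::euclidean_space \<Rightarrow> ennreal" and K :: ennreal
  assumes "U \<in> sets borel" and f[measurable]: "f \<in> borel_measurable borel"
  shows "(\<lambda>x. K ^ fst (greedy U x k) * f (snd (greedy U x k)))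
    \<in> borel_measurable (\<Pi>\<^sub>M i\<in>{..<k}. borel)"
proof -
  have [measurable]: "(\<lambda>x. fst (greedy U x k)) \<in> measurable (\<Pi>\<^sub>M i\<in>{..<k}. borel) (count_space UNIV)"
    "(\<lambda>x. snd (greedy U x k)) \<in> borel_measurable (\<Pi>\<^sub>M i\<in>{..<k}. borel)"
    using measurable_greedy[OF assms(1) order_refl] by auto
  have "(\<lambda>x. K ^ fst (greedy U x k)) \<in> borel_measurable (\<Pi>\<^sub>M i\<in>{..<k}. borel)"
    by (rule measurable_compose[of "\<lambda>x. fst (greedy U x k)" _ "count_space UNIV"]) auto
  then show ?thesis by measurable
qed

text \<open>Supermartingale argument. Opening a ball gains a factor \<open>K\<close> and resets the
  value of \<open>f\<close> to \<open>f 0\<close>, at most 1; but it happens only outside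
  \<open>U\<close>, where \<open>f\<close> was at least \<open>K\<close>. So it never raises the
  weight, and each step costs at most the factor \<open>Q\<close>.\<close>

lemma greedy_exp_moment:
  fixes \<mu> :: "'a::euclidean_space measure" and f :: "'a \<Rightarrow> ennreal" and K Q :: ennreal
  assumes \<mu>: "prob_space \<mu>" and sets[measurable_cong]: "sets \<mu> = sets borel"
    and U[measurable]: "U \<in> sets borel" and f[measurable]: "f \<in> borel_measurable borel"
    and f0: "f 0 \<le> 1" and fK: "\<And>x. x \<notin> U \<Longrightarrow> K \<le> f x"
    and step: "\<And>y. (\<integral>\<^sup>+x. f (y + x) \<partial>\<mu>) \<le> Q * f y"
  shows "(\<integral>\<^sup>+x. K ^ fst (greedy U x k) * f (snd (greedy U x k)) \<partial>(\<Pi>\<^sub>M i\<in>{..<k}. \<mu>)) \<le> Q ^ k"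
proof (induction k)
  case 0
  interpret product_prob_space "\<lambda>_::nat. \<mu>" by (rule product_prob_spaceI) (rule \<mu>)
  show ?case using f0 by (simp add: PiM_empty nn_integral_count_space_finite)
next
  case (Suc k)
  interpret product_prob_space "\<lambda>_::nat. \<mu>" by (rule product_prob_spaceI) (rule \<mu>)
  let ?\<Phi> = "\<lambda>k x. K ^ fst (greedy U x k) * f (snd (greedy U x k))"
  have sp: "sets (\<Pi>\<^sub>M i\<in>{..<j}. \<mu>) = sets (\<Pi>\<^sub>M i\<in>{..<j}. (borel::'a measure))" for j :: nat
    by (intro sets_PiM_cong) (auto simp: sets)
  have meas: "?\<Phi> j \<in> borel_measurable (\<Pi>\<^sub>M i\<in>{..<j}. \<mu>)" for j
    unfolding measurable_cong_sets[OF sp refl] by (rule borel_measurable_greedy_weight[OF U f])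
  have ins: "{..<Suc k} = insert k {..<k}" by auto
  have "(\<integral>\<^sup>+x. ?\<Phi> (Suc k) x \<partial>(\<Pi>\<^sub>M i\<in>{..<Suc k}. \<mu>))
      = (\<integral>\<^sup>+x. (\<integral>\<^sup>+y. ?\<Phi> (Suc k) (x(k := y)) \<partial>\<mu>) \<partial>(\<Pi>\<^sub>M i\<in>{..<k}. \<mu>))"
    unfolding ins by (rule product_nn_integral_insert) (use meas[of "Suc k"] ins in auto)
  also have "\<dots> \<le> (\<integral>\<^sup>+x. Q * ?\<Phi> k x \<partial>(\<Pi>\<^sub>M i\<in>{..<k}. \<mu>))"
  proof (intro nn_integral_mono)
    fix x :: "nat \<Rightarrow> 'a"
    let ?N = "fst (greedy U x k)" and ?d = "snd (greedy U x k)"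
    \<comment> \<open>The last increment, which is integrated first, does not affect the first
      \<open>k\<close> steps.\<close>
    have upd: "greedy U (x(k := y)) k = greedy U x k" for y by (rule greedy_cong) simp
    have "?\<Phi> (Suc k) (x(k := y)) \<le> K ^ ?N * f (?d + y)" for y
    proof (cases "?d + y \<in> U")
      case False
      have "K * f 0 \<le> f (?d + y)"
        using mult_mono[OF fK[OF False] f0] by simp
      then have "K ^ ?N * (K * f 0) \<le> K ^ ?N * f (?d + y)" by (rule mult_left_mono) simp
      then show ?thesis using False by (simp add: upd mult_ac)
    qed (simp add: upd)
    then have "(\<integral>\<^sup>+y. ?\<Phi> (Suc k) (x(k := y)) \<partial>\<mu>) \<le> (\<integral>\<^sup>+y. K ^ ?N * f (?d + y) \<partial>\<mu>)"
      by (intro nn_integral_mono)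
    also have "\<dots> = K ^ ?N * (\<integral>\<^sup>+y. f (?d + y) \<partial>\<mu>)" by (intro nn_integral_cmult) measurable
    also have "\<dots> \<le> K ^ ?N * (Q * f ?d)" by (intro mult_left_mono step) simp
    finally show "(\<integral>\<^sup>+y. ?\<Phi> (Suc k) (x(k := y)) \<partial>\<mu>) \<le> Q * ?\<Phi> k x" by (simp add: mult_ac)
  qed
  also have "\<dots> = Q * (\<integral>\<^sup>+x. ?\<Phi> k x \<partial>(\<Pi>\<^sub>M i\<in>{..<k}. \<mu>))"
    by (intro nn_integral_cmult meas)
  also have "\<dots> \<le> Q * Q ^ k" by (intro mult_left_mono Suc) simp
  finally show ?case by simp
qed

section \<open>Gaussian exponential moments and the eigenfunction\<close>

lemma nn_integral_exp_normal_density: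
  assumes "\<sigma> > 0"
  shows "(\<integral>\<^sup>+y. ennreal (exp (a * y) * normal_density 0 \<sigma> y) \<partial>lborel) = ennreal (exp (a\<^sup>2 * \<sigma>\<^sup>2 / 2))"
proof -
  have eq: "exp (a * y) * normal_density 0 \<sigma> y
      = exp (a\<^sup>2 * \<sigma>\<^sup>2 / 2) * normal_density (a * \<sigma>\<^sup>2) \<sigma> y" for y
  proof -
    \<comment> \<open>Completing the square: the exponential tilt only moves the mean to
      \<open>a * \<sigma>\<^sup>2\<close>.\<close>
    have "a * y + - (y - 0)\<^sup>2 / (2 * \<sigma>\<^sup>2) = a\<^sup>2 * \<sigma>\<^sup>2 / 2 + - (y - a * \<sigma>\<^sup>2)\<^sup>2 / (2 * \<sigma>\<^sup>2)"
      using assms by (simp add: field_simps power2_eq_square)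
    then have "exp (a * y) * exp (- (y - 0)\<^sup>2 / (2 * \<sigma>\<^sup>2))
        = exp (a\<^sup>2 * \<sigma>\<^sup>2 / 2) * exp (- (y - a * \<sigma>\<^sup>2)\<^sup>2 / (2 * \<sigma>\<^sup>2))"
      by (metis exp_add)
    then show ?thesis unfolding normal_density_def by (simp add: mult_ac)
  qed
  interpret prob_space "density lborel (normal_density (a * \<sigma>\<^sup>2) \<sigma>)"
    using assms by (rule prob_space_normal_density)
  have "(\<integral>\<^sup>+y. ennreal (normal_density (a * \<sigma>\<^sup>2) \<sigma> y) \<partial>lborel) = 1"
    using emeasure_space_1 by (simp add: emeasure_density)
  then show ?thesis
    unfolding eq by (simp add: ennreal_mult nn_integral_cmult)
qed

lemma nn_integral_exp_inner_normal:
  fixes v :: "'a::euclidean_space"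
  assumes "\<sigma> > 0"
  shows "(\<integral>\<^sup>+x. ennreal (exp (v \<bullet> x)) * ennreal (\<Prod>b\<in>Basis. normal_density 0 \<sigma> (x \<bullet> b)) \<partial>lborel)
    = ennreal (exp ((norm v)\<^sup>2 * \<sigma>\<^sup>2 / 2))"
proof -
  have "exp (v \<bullet> x) * (\<Prod>b\<in>Basis. normal_density 0 \<sigma> (x \<bullet> b))
      = (\<Prod>b\<in>Basis. exp ((v \<bullet> b) * (x \<bullet> b)) * normal_density 0 \<sigma> (x \<bullet> b))" for x
    by (subst euclidean_inner) (simp add: exp_sum prod.distrib)
  then have "(\<integral>\<^sup>+x. ennreal (exp (v \<bullet> x)) * ennreal (\<Prod>b\<in>Basis. normal_density 0 \<sigma> (x \<bullet> b)) \<partial>lborel)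
      = (\<integral>\<^sup>+x. (\<Prod>b\<in>Basis. ennreal (exp ((v \<bullet> b) * (x \<bullet> b)) * normal_density 0 \<sigma> (x \<bullet> b))) \<partial>lborel)"
    by (simp add: ennreal_mult'[symmetric] prod_ennreal)
  also have "\<dots> = (\<Prod>b\<in>Basis. ennreal (exp ((v \<bullet> b)\<^sup>2 * \<sigma>\<^sup>2 / 2)))"
    using assms by (subst nn_integral_lborel_prod) (auto simp: nn_integral_exp_normal_density)
  also have "\<dots> = ennreal (exp (\<Sum>b\<in>Basis. (v \<bullet> b)\<^sup>2 * \<sigma>\<^sup>2 / 2))"
    by (simp add: prod_ennreal exp_sum)
  also have "(\<Sum>b\<in>Basis. (v \<bullet> b)\<^sup>2 * \<sigma>\<^sup>2 / 2) = (norm v)\<^sup>2 * \<sigma>\<^sup>2 / 2"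
    unfolding power2_norm_eq_inner
    by (subst euclidean_inner) (simp add: power2_eq_square sum_distrib_right sum_divide_distrib)
  finally show ?thesis .
qed

text \<open>An average of exponentials whose frequency vectors, plus or minus
  \<open>\<theta> *\<^sub>R b\<close>, all have the same length and hence the same eigenvalue under
  an isotropic Gaussian kernel. Unlike a single exponential it is large far from the origin in every
  direction.\<close>

definition cosh_mean :: "real \<Rightarrow> 'a::euclidean_space \<Rightarrow> real" where
  "cosh_mean \<theta> x = (\<Sum>b\<in>Basis. cosh (\<theta> * (x \<bullet> b))) / DIM('a)"

lemma cosh_mean_0 [simp]: "cosh_mean \<theta> 0 = 1"
  by (simp add: cosh_mean_def)

lemma cosh_mean_ge_1: "1 \<le> cosh_mean \<theta> x"
proof -
  have "real DIM('a) = (\<Sum>b\<in>(Basis::'a set). 1)" by simp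
  also have "\<dots> \<le> (\<Sum>b\<in>Basis. cosh (\<theta> * (x \<bullet> b)))"
    by (intro sum_mono cosh_real_ge_1)
  finally show ?thesis by (simp add: cosh_mean_def field_simps)
qed

lemma continuous_cosh_mean: "continuous_on A (cosh_mean \<theta>)"
  unfolding cosh_mean_def by (intro continuous_intros) auto

lemma borel_measurable_cosh_mean [measurable]: "cosh_mean \<theta> \<in> borel_measurable borel"
  by (intro borel_measurable_continuous_onI continuous_cosh_mean)

text \<open>A small mean bounds every summand, hence every coordinate, and the norm is at most the
  l1 norm. One factor \<open>DIM('a)\<close> pays for the averaging, the other for the sum of
  coordinates.\<close>

lemma norm_less_of_cosh_mean_less:
  fixes x :: "'a::euclidean_space"
  assumes "\<theta> > 0" "\<rho> > 0" "cosh_mean \<theta> x < cosh (\<theta> * \<rho> / DIM('a)) / DIM('a)"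
  shows "norm x < \<rho>"
proof -
  have "\<bar>x \<bullet> b\<bar> < \<rho> / DIM('a)" if b: "b \<in> Basis" for b :: 'a
  proof -
    have "cosh (\<theta> * (x \<bullet> b)) \<le> (\<Sum>b\<in>Basis. cosh (\<theta> * (x \<bullet> b)))"
      using b by (intro member_le_sum) auto
    also have "\<dots> < cosh (\<theta> * \<rho> / DIM('a))"
      using assms(3) by (simp add: cosh_mean_def divide_less_cancel)
    finally have "cosh \<bar>\<theta> * (x \<bullet> b)\<bar> < cosh (\<theta> * \<rho> / DIM('a))" by simp
    then have "\<bar>\<theta> * (x \<bullet> b)\<bar> < \<theta> * \<rho> / DIM('a)"
      using assms by (subst (asm) cosh_real_nonneg_less_iff) auto
    then show ?thesis using assms by (simp add: abs_mult field_simps)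
  qed
  then have "(\<Sum>b\<in>Basis. \<bar>x \<bullet> b\<bar>) < (\<Sum>b\<in>(Basis::'a set). \<rho> / DIM('a))"
    by (intro sum_strict_mono) auto
  then show ?thesis using norm_le_l1[of x] by simp
qed

text \<open>Supplies the hypothesis \<open>step\<close> of \<open>greedy_exp_moment\<close>, with
  equality.\<close>

lemma nn_integral_cosh_mean_normal:
  fixes y :: "'a::euclidean_space"
  assumes "\<sigma> > 0"
  shows "(\<integral>\<^sup>+x. ennreal (cosh_mean \<theta> (y + x))
      \<partial>density lborel (\<lambda>x. ennreal (\<Prod>b\<in>Basis. normal_density 0 \<sigma> (x \<bullet> b))))
    = ennreal (exp (\<theta>\<^sup>2 * \<sigma>\<^sup>2 / 2)) * ennreal (cosh_mean \<theta> y)"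
proof -
  let ?g = "\<lambda>x. ennreal (\<Prod>b\<in>Basis. normal_density 0 \<sigma> (x \<bullet> (b::'a)))"
  let ?c = "1 / (2 * real DIM('a))"
  let ?E = "exp (\<theta>\<^sup>2 * \<sigma>\<^sup>2 / 2)"
  have cm: "ennreal (cosh_mean \<theta> z) = (\<Sum>b\<in>Basis.
      ennreal (?c * exp ((\<theta> *\<^sub>R b) \<bullet> z)) + ennreal (?c * exp ((- \<theta> *\<^sub>R b) \<bullet> z)))" for z :: 'a
  proof -
    have "cosh_mean \<theta> z = (\<Sum>b\<in>Basis.
        ?c * exp ((\<theta> *\<^sub>R b) \<bullet> z) + ?c * exp ((- \<theta> *\<^sub>R b) \<bullet> z))"
      by (simp add: cosh_mean_def cosh_field_def sum_divide_distrib inner_commute field_simps)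
    then show ?thesis
      by (simp only: ennreal_plus sum_ennreal[symmetric] add_nonneg_nonneg mult_nonneg_nonneg
          zero_le_divide_iff zero_le_one zero_le_mult_iff of_nat_0_le_iff zero_le_numeral exp_ge_zero simp_thms)
  qed
  have split: "ennreal (?c * exp (v \<bullet> (y + x))) = ennreal (?c * exp (v \<bullet> y)) * ennreal (exp (v \<bullet> x))"
    for v x
    by (simp add: inner_add_right exp_add flip: ennreal_mult)
  have "ennreal (cosh_mean \<theta> (y + x)) * ?g x = (\<Sum>b\<in>Basis.
      ennreal (?c * exp ((\<theta> *\<^sub>R b) \<bullet> y)) * (ennreal (exp ((\<theta> *\<^sub>R b) \<bullet> x)) * ?g x)
      + ennreal (?c * exp ((- \<theta> *\<^sub>R b) \<bullet> y)) * (ennreal (exp ((- \<theta> *\<^sub>R b) \<bullet> x)) * ?g x))" for x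
    unfolding cm split by (simp only: sum_distrib_right distrib_right mult.assoc)
  then have "(\<integral>\<^sup>+x. ennreal (cosh_mean \<theta> (y + x)) \<partial>density lborel ?g) = (\<Sum>b\<in>Basis.
      ennreal (?c * exp ((\<theta> *\<^sub>R b) \<bullet> y)) * (\<integral>\<^sup>+x. ennreal (exp ((\<theta> *\<^sub>R b) \<bullet> x)) * ?g x \<partial>lborel)
      + ennreal (?c * exp ((- \<theta> *\<^sub>R b) \<bullet> y)) * (\<integral>\<^sup>+x. ennreal (exp ((- \<theta> *\<^sub>R b) \<bullet> x)) * ?g x \<partial>lborel))"
    by (simp add: nn_integral_density mult.commute[of "?g _"] nn_integral_sum nn_integral_add nn_integral_cmult)
  also have "\<dots> = (\<Sum>b\<in>(Basis::'a set). ennreal (?c * exp ((\<theta> *\<^sub>R b) \<bullet> y)) * ennreal ?E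
      + ennreal (?c * exp ((- \<theta> *\<^sub>R b) \<bullet> y)) * ennreal ?E)"
    using assms by (intro sum.cong refl) (simp only: nn_integral_exp_inner_normal, simp)
  also have "\<dots> = ennreal ?E * ennreal (cosh_mean \<theta> y)"
    unfolding cm by (simp only: sum_distrib_left distrib_left mult.commute)
  finally show ?thesis .
qed

section \<open>The greedy covering of a Brownian path\<close>

lemma (in standard_brownian_motion) greedy_increments_exp_moment:
  fixes \<theta> K h :: real and m :: nat
  assumes m: "m > 0" and h: "h > 0" and K: "K > 0"
  defines "U \<equiv> {x. cosh_mean \<theta> x < K}"
    and "X \<equiv> \<lambda>\<omega> i. B (real (Suc i) * h) \<omega> - B (real i * h) \<omega>"
  shows "(\<lambda>\<omega>. fst (greedy U (X \<omega>) m)) \<in> measurable M (count_space UNIV)"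
    and "(\<integral>\<^sup>+\<omega>. ennreal K ^ fst (greedy U (X \<omega>) m) \<partial>M) \<le> ennreal (exp (\<theta>\<^sup>2 * (m * h) / 2))"
proof -
  define \<mu> where
    "\<mu> = density lborel (\<lambda>x::'a. ennreal (\<Prod>b\<in>Basis. normal_density 0 (sqrt h) (x \<bullet> b)))"
  have U: "U \<in> sets borel"
    unfolding U_def by measurable
  have B[measurable]: "B (real i * h) \<in> borel_measurable M" for i
    using h by (intro measurable_BM) simp
  have X[measurable]: "(\<lambda>\<omega>. X \<omega> i) \<in> borel_measurable M" for i
    unfolding X_def by (intro borel_measurable_diff B)
  have XP[measurable]: "(\<lambda>\<omega>. \<lambda>i\<in>{..<m}. X \<omega> i) \<in> measurable M (\<Pi>\<^sub>M i\<in>{..<m}. borel)"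
    by (intro measurable_restrict X)
  have gr: "greedy U (X \<omega>) m = greedy U (\<lambda>i\<in>{..<m}. X \<omega> i) m" for \<omega>
    by (rule greedy_cong) simp
  show "(\<lambda>\<omega>. fst (greedy U (X \<omega>) m)) \<in> measurable M (count_space UNIV)"
    unfolding gr using measurable_compose[OF XP] measurable_greedy[OF U order_refl] by blast
  have distr_X: "distr M borel (\<lambda>\<omega>. X \<omega> i) = \<mu>" for i
  proof -
    have "distributed M lborel (\<lambda>\<omega>. X \<omega> i)
        (\<lambda>x. ennreal (\<Prod>b\<in>Basis. normal_density 0 (sqrt (real (Suc i) * h - real i * h)) (x \<bullet> b)))"
      unfolding X_def using h by (intro gaussian_increments) auto
    then have "distr M lborel (\<lambda>\<omega>. X \<omega> i) = \<mu>"
      unfolding \<mu>_def by (subst distributed_distr_eq_density) (auto simp: algebra_simps)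
    moreover have "distr M lborel (\<lambda>\<omega>. X \<omega> i) = distr M borel (\<lambda>\<omega>. X \<omega> i)"
      by (rule distr_cong) auto
    ultimately show ?thesis by simp
  qed
  have prob: "prob_space \<mu>"
    unfolding distr_X[symmetric, of 0] by (rule prob_space_distr) (rule X)
  have "indep_vars (\<lambda>_. borel) (\<lambda>i \<omega>. X \<omega> i) {..<m}"
    unfolding X_def using h by (intro independent_increments) auto
  \<comment> \<open>Independence becomes a product law, the setting of
    \<open>greedy_exp_moment\<close>.\<close>
  then have "distr M (\<Pi>\<^sub>M i\<in>{..<m}. borel) (\<lambda>\<omega>. \<lambda>i\<in>{..<m}. X \<omega> i)
      = (\<Pi>\<^sub>M i\<in>{..<m}. distr M borel (\<lambda>\<omega>. X \<omega> i))"
    using m by (subst (asm) indep_vars_iff_distr_eq_PiM') auto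
  then have distr: "distr M (\<Pi>\<^sub>M i\<in>{..<m}. borel) (\<lambda>\<omega>. \<lambda>i\<in>{..<m}. X \<omega> i) = (\<Pi>\<^sub>M i\<in>{..<m}. \<mu>)"
    by (simp add: distr_X)
  let ?f = "\<lambda>x::'a. ennreal (cosh_mean \<theta> x)"
  let ?\<Phi> = "\<lambda>x. ennreal K ^ fst (greedy U x m) * ?f (snd (greedy U x m))"
  have f: "?f \<in> borel_measurable borel" by measurable
  have \<Phi>: "?\<Phi> \<in> borel_measurable (\<Pi>\<^sub>M i\<in>{..<m}. borel)"
    by (rule borel_measurable_greedy_weight[OF U f])
  \<comment> \<open>The factor \<open>cosh_mean\<close> may be inserted since it is at least
    1.\<close>
  have "ennreal K ^ fst (greedy U (X \<omega>) m) \<le> ?\<Phi> (\<lambda>i\<in>{..<m}. X \<omega> i)" for \<omega>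
    unfolding gr using mult_left_mono[OF ennreal_leI[OF cosh_mean_ge_1]] by fastforce
  then have "(\<integral>\<^sup>+\<omega>. ennreal K ^ fst (greedy U (X \<omega>) m) \<partial>M)
      \<le> (\<integral>\<^sup>+\<omega>. ?\<Phi> (\<lambda>i\<in>{..<m}. X \<omega> i) \<partial>M)"
    by (intro nn_integral_mono)
  also have "\<dots> = (\<integral>\<^sup>+x. ?\<Phi> x \<partial>(\<Pi>\<^sub>M i\<in>{..<m}. \<mu>))"
    unfolding distr[symmetric]
    by (rule nn_integral_distr[OF XP, symmetric]) (simp add: \<Phi>)
  also have "\<dots> \<le> ennreal (exp (\<theta>\<^sup>2 * h / 2)) ^ m"
  proof (rule greedy_exp_moment[OF prob _ U f])
    show "sets \<mu> = sets borel" by (simp add: \<mu>_def)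
    show "ennreal K \<le> ?f x" if "x \<notin> U" for x
      using that by (intro ennreal_leI) (simp add: U_def)
    show "(\<integral>\<^sup>+x. ?f (y + x) \<partial>\<mu>) \<le> ennreal (exp (\<theta>\<^sup>2 * h / 2)) * ?f y" for y
      unfolding \<mu>_def using nn_integral_cosh_mean_normal[of "sqrt h" \<theta> y] h by simp
  qed simp
  \<comment> \<open>Only the total time \<open>m * h\<close> survives, so the bound is uniform in
    the mesh.\<close>
  also have "\<dots> = ennreal (exp (\<theta>\<^sup>2 * (m * h) / 2))"
    by (simp add: ennreal_power exp_of_nat_mult[symmetric] mult_ac)
  finally show "(\<integral>\<^sup>+\<omega>. ennreal K ^ fst (greedy U (X \<omega>) m) \<partial>M) \<le> ennreal (exp (\<theta>\<^sup>2 * (m * h) / 2))" .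
qed

text \<open>Markov's inequality for \<open>exp (L * N)\<close>. The number of balls is
  \<open>Suc (N \<omega>)\<close>, whence \<open>y - 1\<close> in the exponent.\<close>

lemma (in standard_brownian_motion) greedy_increments_tail:
  fixes \<theta> L h y :: real and m :: nat
  assumes m: "m > 0" and h: "h > 0"
  defines "N \<equiv> \<lambda>\<omega>. fst (greedy {x. cosh_mean \<theta> x < exp L}
      (\<lambda>i. B (real (Suc i) * h) \<omega> - B (real i * h) \<omega>) m)"
  assumes L: "L \<ge> 0"
  shows "{\<omega> \<in> space M. y \<le> real (Suc (N \<omega>))} \<in> sets M"
    and "measure M {\<omega> \<in> space M. y \<le> real (Suc (N \<omega>))} \<le> exp (\<theta>\<^sup>2 * (m * h) / 2 - L * (y - 1))"
proof -
  let ?A = "{\<omega> \<in> space M. y \<le> real (Suc (N \<omega>))}"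
  have N[measurable]: "N \<in> measurable M (count_space UNIV)"
    unfolding N_def by (rule greedy_increments_exp_moment(1)[OF m h]) simp
  show A[measurable]: "?A \<in> sets M" by measurable
  have "ennreal (exp (L * (y - 1))) * emeasure M ?A
      = (\<integral>\<^sup>+\<omega>. ennreal (exp (L * (y - 1))) * indicator ?A \<omega> \<partial>M)"
    by (rule nn_integral_cmult_indicator[symmetric]) (rule A)
  also have "\<dots> \<le> (\<integral>\<^sup>+\<omega>. ennreal (exp L) ^ N \<omega> \<partial>M)"
  proof (intro nn_integral_mono)
    fix \<omega>
    show "ennreal (exp (L * (y - 1))) * indicator ?A \<omega> \<le> ennreal (exp L) ^ N \<omega>"
    proof (cases "\<omega> \<in> ?A")
      case True
      then have "L * (y - 1) \<le> real (N \<omega>) * L"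
        using L by (subst mult.commute) (intro mult_right_mono, auto)
      with True show ?thesis
        by (simp add: ennreal_power exp_of_nat_mult[symmetric])
    qed simp
  qed
  also have "\<dots> \<le> ennreal (exp (\<theta>\<^sup>2 * (m * h) / 2))"
    unfolding N_def by (rule greedy_increments_exp_moment(2)[OF m h]) simp
  finally have "exp (L * (y - 1)) * measure M ?A \<le> exp (\<theta>\<^sup>2 * (m * h) / 2)"
    by (simp add: emeasure_eq_measure flip: ennreal_mult)
  then show "measure M ?A \<le> exp (\<theta>\<^sup>2 * (m * h) / 2 - L * (y - 1))"
    unfolding exp_diff by (simp add: pos_le_divide_eq mult.commute)
qed

section \<open>From the sampled path to the whole sausage\<close>

lemma wiener_sausage_greedy_cover:
  fixes w :: "real \<Rightarrow> 'a::euclidean_space"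
  assumes w: "continuous_on {0..} w" and t: "t > 0" and r: "r > 0"
    and U: "0 \<in> U" "\<And>x. x \<in> U \<Longrightarrow> norm x < r"
  shows "\<exists>m0. \<forall>m\<ge>m0. \<exists>c. wiener_sausage r t w \<subseteq>
    (\<Union>l<Suc (fst (greedy U (\<lambda>i. w (real (Suc i) * (t / real (Suc m))) - w (real i * (t / real (Suc m)))) (Suc m))).
      ball (c l) (3 * r))"
proof -
  have "uniformly_continuous_on {0..t} w"
    by (intro compact_uniformly_continuous continuous_on_subset[OF w]) auto
  then obtain \<delta> where \<delta>: "\<delta> > 0"
    "\<And>s s'. s \<in> {0..t} \<Longrightarrow> s' \<in> {0..t} \<Longrightarrow> dist s' s < \<delta> \<Longrightarrow> dist (w s') (w s) < r"
    using r unfolding uniformly_continuous_on_def by metis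
  \<comment> \<open>From \<open>m0\<close> on, the mesh \<open>t / real (Suc m)\<close> is below
    \<open>\<delta>\<close>.\<close>
  obtain m0 where m0: "t / \<delta> < real m0" using reals_Archimedean2 by blast
  have "\<exists>c. wiener_sausage r t w \<subseteq>
    (\<Union>l<Suc (fst (greedy U (\<lambda>i. w (real (Suc i) * (t / real (Suc m))) - w (real i * (t / real (Suc m)))) (Suc m))).
      ball (c l) (3 * r))" if m: "m \<ge> m0" for m
  proof -
    define h where "h = t / real (Suc m)"
    let ?g = "greedy U (\<lambda>i. w (real (Suc i) * h) - w (real i * h)) (Suc m)"
    have h: "h > 0" "h < \<delta>"
    proof -
      show "h > 0" using t by (simp add: h_def)
      have "t < real m0 * \<delta>" using m0 \<delta>(1) by (simp add: pos_divide_less_eq)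
      also have "\<dots> \<le> real (Suc m) * \<delta>" using m \<delta>(1) by (intro mult_right_mono) auto
      finally show "h < \<delta>" by (simp add: h_def pos_divide_less_eq mult.commute del: of_nat_Suc)
    qed
    obtain c where c: "\<And>i. i \<le> Suc m \<Longrightarrow> \<exists>l\<le>fst ?g. w (real i * h) - c l \<in> U"
      using greedy_cover[OF U(1), of "\<lambda>i. w (real i * h)" "Suc m"] by blast
    have "wiener_sausage r t w \<subseteq> (\<Union>l<Suc (fst ?g). ball (c l) (3 * r))"
    proof
      fix z assume "z \<in> wiener_sausage r t w"
      then obtain s where s: "0 \<le> s" "s \<le> t" "dist (w s) z < r"
        by (auto simp: wiener_sausage_def)
      \<comment> \<open>The last sample time not after \<open>s\<close>; for \<open>s = t\<close> it
        is the final one, with index \<open>Suc m\<close>.\<close>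
      define i where "i = nat \<lfloor>s / h\<rfloor>"
      have i: "real i \<le> s / h" "s / h < real i + 1"
        using s h by (auto simp: i_def)
      then have ih: "real i * h \<le> s" "s < real i * h + h"
        using h by (simp_all add: field_simps)
      have "s / h \<le> real (Suc m)"
        using s(2) h(1) t by (simp add: pos_divide_le_eq) (simp add: h_def)
      then have "i \<le> Suc m" using i by linarith
      then obtain l where l: "l \<le> fst ?g" "w (real i * h) - c l \<in> U" using c by blast
      have "dist (w s) (w (real i * h)) < r"
        using ih s h by (intro \<delta>) (auto simp: dist_real_def)
      moreover have "dist (c l) (w (real i * h)) < r"
        using U(2)[OF l(2)] by (simp add: dist_norm norm_minus_commute)
      \<comment> \<open>One \<open>r\<close> each for the sausage, for the path between sample
        times, and for the set \<open>U\<close>.\<close>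
      ultimately have "dist (c l) z < 3 * r"
        using s(3) dist_triangle[of "c l" z "w s"] dist_triangle[of "c l" "w s" "w (real i * h)"]
        by (simp add: dist_commute)
      then show "z \<in> (\<Union>l<Suc (fst ?g). ball (c l) (3 * r))"
        using l(1) by (auto simp: less_Suc_eq_le)
    qed
    then show ?thesis unfolding h_def by blast
  qed
  then show ?thesis by blast
qed

text \<open>The set \<open>E\<close> need not be measurable; if it is not, its \<^const>\<open>measure\<close> is \<open>0\<close>.\<close>

lemma (in finite_measure) measure_le_of_eventually_mem:
  fixes A :: "nat \<Rightarrow> 'a set"
  assumes A: "\<And>m. A m \<in> sets M" "\<And>m. measure M (A m) \<le> b"
    and E: "\<And>\<omega>. \<omega> \<in> E \<Longrightarrow> \<exists>m0. \<forall>m\<ge>m0. \<omega> \<in> A m"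
  shows "measure M E \<le> b"
proof -
  \<comment> \<open>\<open>F\<close> increases to the lower limit of the sets \<open>A m\<close>,
    which contains \<open>E\<close>; the bound passes to it by continuity from below.\<close>
  define F where "F k = (\<Inter>m\<in>{k..}. A m)" for k :: nat
  have F: "F k \<in> sets M" for k unfolding F_def using A(1) by (intro sets.countable_INT') auto
  have "incseq F" unfolding F_def by (intro incseq_SucI) auto
  then have "(\<lambda>k. measure M (F k)) \<longlonglongrightarrow> measure M (\<Union>k. F k)"
    using F by (intro finite_Lim_measure_incseq) auto
  moreover have "measure M (F k) \<le> b" for k
    by (rule order_trans[OF finite_measure_mono A(2)[of k]]) (auto simp: F_def A(1))
  ultimately have "measure M (\<Union>k. F k) \<le> b" by (intro LIMSEQ_le_const2) auto
  moreover have "measure M E \<le> measure M (\<Union>k. F k)"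
    using E F by (intro finite_measure_mono) (force simp: F_def)+
  ultimately show ?thesis by simp
qed

section \<open>Choice of the constants and the tail bound\<close>

lemma ex_cosh_scale:
  assumes "D \<ge> 1" "r > 0" "L \<ge> 0"
  shows "\<exists>\<theta>>0. exp L \<le> cosh (\<theta> * r / D) / (D::real)"
proof -
  have "filterlim (\<lambda>\<theta>. cosh (\<theta> * r / D) / D) at_top at_top"
    using assms by real_asymp
  then have "eventually (\<lambda>\<theta>. exp L \<le> cosh (\<theta> * r / D) / D) at_top"
    by (simp add: filterlim_at_top)
  then have "eventually (\<lambda>\<theta>. \<theta> > 0 \<and> exp L \<le> cosh (\<theta> * r / D) / D) at_top"
    using eventually_gt_at_top[of 0] by eventually_elim auto
  then show ?thesis by (auto dest: eventually_happens)
qed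

text \<open>\<open>j0\<close> depends on \<open>r\<close> and \<open>t0\<close>: the sausage always
  contains a ball of radius \<open>r\<close>, so for fixed \<open>j\<close> the event is certain
  once \<open>t\<close> is small enough.\<close>

lemma wiener_sausage_capacity_tail:
  fixes r t0 :: real
  assumes dim: "DIM('a::euclidean_space) \<ge> 4" and r: "r > 0" and t0: "t0 > 0"
  shows "\<exists>j0. \<forall>(M::'w measure) (B::real \<Rightarrow> 'w \<Rightarrow> 'a). standard_brownian_motion M B \<longrightarrow>
    (\<forall>t\<ge>t0. \<forall>j\<ge>j0. measure M {\<omega> \<in> space M.
      newtonian_capacity (wiener_sausage r t (\<lambda>s. B s \<omega>)) \<ge> ennreal (j * t * r ^ (DIM('a) - 4))}
    \<le> exp (- (j * t)))"
proof -
  obtain C where C: "C > 0" "\<And>(A::'a set) n c R. R > 0 \<Longrightarrow> A \<subseteq> (\<Union>i<n. ball (c i) R) \<Longrightarrow>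
      newtonian_capacity A \<le> ennreal (real n * C * R ^ (DIM('a) - 2))"
    using capacity_cover_bound[where 'a='a] dim by auto
  \<comment> \<open>By \<open>D_eq\<close>, n balls of radius \<open>3 * r\<close> have capacity at
    most n times \<open>D * r ^ (DIM('a) - 4)\<close>.\<close>
  define D where "D = C * 3 ^ (DIM('a) - 2) * r\<^sup>2"
  have D: "D > 0" using C r by (simp add: D_def)
  have D_eq: "C * (3 * r) ^ (DIM('a) - 2) = D * r ^ (DIM('a) - 4)"
  proof -
    have "DIM('a) - 2 = 2 + (DIM('a) - 4)" using dim by simp
    then have "r ^ (DIM('a) - 2) = r\<^sup>2 * r ^ (DIM('a) - 4)" by (metis power_add)
    then show ?thesis by (simp add: D_def power_mult_distrib mult_ac)
  qed
  \<comment> \<open>With \<open>L = 2 * D\<close>, having \<open>j * t / D\<close> balls yields the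
    exponent \<open>- 2 * j * t\<close>. One half is the claimed rate; the other absorbs the
    errors.\<close>
  obtain \<theta> where \<theta>: "\<theta> > 0" "exp (2 * D) \<le> cosh (\<theta> * r / DIM('a)) / DIM('a)"
    using ex_cosh_scale[of "real DIM('a)" r "2 * D"] D r by (auto simp: Suc_le_eq)
  define U where "U = {x::'a. cosh_mean \<theta> x < exp (2 * D)}"
  have U: "0 \<in> U" "\<And>x. x \<in> U \<Longrightarrow> norm x < r"
    unfolding U_def using D norm_less_of_cosh_mean_less[OF \<theta>(1) r] \<theta>(2) by (auto dest: less_le_trans)
  \<comment> \<open>The errors are \<open>\<theta>\<^sup>2 * t / 2\<close> from the moment bound and
    \<open>2 * D\<close> from the first ball. The latter does not scale with \<open>t\<close> and is
    absorbed using \<open>t0 \<le> t\<close>.\<close>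
  define j0 where "j0 = \<theta>\<^sup>2 / 2 + 2 * D / t0"
  show ?thesis
  proof (intro exI[of _ j0] allI impI)
    fix M :: "'w measure" and B :: "real \<Rightarrow> 'w \<Rightarrow> 'a" and t j :: real
    assume BM: "standard_brownian_motion M B" and t: "t0 \<le> t" and j: "j0 \<le> j"
    interpret standard_brownian_motion M B by fact
    have tpos: "t > 0" using t t0 by simp
    define N where "N m \<omega> = fst (greedy U (\<lambda>i. B (real (Suc i) * (t / real (Suc m))) \<omega>
        - B (real i * (t / real (Suc m))) \<omega>) (Suc m))" for m \<omega>
    let ?A = "\<lambda>m. {\<omega> \<in> space M. j * t / D \<le> real (Suc (N m \<omega>))}"
    have h: "t / real (Suc m) > 0" for m using tpos by simp
    have LD: "2 * D \<ge> 0" using D by simp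
    have tail: "?A m \<in> sets M" "measure M (?A m)
        \<le> exp (\<theta>\<^sup>2 * (real (Suc m) * (t / real (Suc m))) / 2 - 2 * D * (j * t / D - 1))" for m
      unfolding N_def U_def by (rule greedy_increments_tail[OF zero_less_Suc h LD])+
    show "measure M {\<omega> \<in> space M. newtonian_capacity (wiener_sausage r t (\<lambda>s. B s \<omega>))
        \<ge> ennreal (j * t * r ^ (DIM('a) - 4))} \<le> exp (- (j * t))"
    \<comment> \<open>How fine the mesh must be depends on the path, so the event lies in
      \<open>?A m\<close> only eventually.\<close>
    proof (rule measure_le_of_eventually_mem)
      show "?A m \<in> sets M" for m by (rule tail(1))
      have "2 * D \<le> 2 * D / t0 * t"
        using t t0 D by (simp add: field_simps)
      moreover have "j0 * t \<le> j * t" using j tpos by simp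
      ultimately have le: "\<theta>\<^sup>2 * t / 2 - 2 * D * (j * t / D - 1) \<le> - (j * t)"
        using D by (simp add: j0_def algebra_simps)
      show "measure M (?A m) \<le> exp (- (j * t))" for m
        by (rule order_trans[OF tail(2)]) (use le in simp)
    next
      fix \<omega>
      assume "\<omega> \<in> {\<omega> \<in> space M. newtonian_capacity (wiener_sausage r t (\<lambda>s. B s \<omega>))
        \<ge> ennreal (j * t * r ^ (DIM('a) - 4))}"
      then have \<omega>: "\<omega> \<in> space M" and cap: "ennreal (j * t * r ^ (DIM('a) - 4))
          \<le> newtonian_capacity (wiener_sausage r t (\<lambda>s. B s \<omega>))" by auto
      obtain m0 where m0: "\<And>m. m \<ge> m0 \<Longrightarrow> \<exists>c. wiener_sausage r t (\<lambda>s. B s \<omega>)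
          \<subseteq> (\<Union>l<Suc (N m \<omega>). ball (c l) (3 * r))"
        using wiener_sausage_greedy_cover[OF continuous_paths[OF \<omega>] tpos r U] unfolding N_def by blast
      have "\<omega> \<in> ?A m" if m: "m \<ge> m0" for m
      proof -
        obtain c where "wiener_sausage r t (\<lambda>s. B s \<omega>) \<subseteq> (\<Union>l<Suc (N m \<omega>). ball (c l) (3 * r))"
          using m0[OF m] by blast
        from order_trans[OF cap C(2)[OF _ this]] r
        have "ennreal (j * t * r ^ (DIM('a) - 4)) \<le> ennreal (real (Suc (N m \<omega>)) * D * r ^ (DIM('a) - 4))"
          unfolding mult.assoc D_eq by simp
        then have "j * t * r ^ (DIM('a) - 4) \<le> real (Suc (N m \<omega>)) * D * r ^ (DIM('a) - 4)"
          using D r by (subst (asm) ennreal_le_iff) auto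
        then have "j * t \<le> real (Suc (N m \<omega>)) * D"
          using r by (subst (asm) mult_le_cancel_right_pos) auto
        then show ?thesis using D \<omega> by (simp add: field_simps)
      qed
      then show "\<exists>m0. \<forall>m\<ge>m0. \<omega> \<in> ?A m" by blast
    qed
  qed
qed

theorem lemma3p5:
  assumes "CARD('d::finite) \<ge> 5"
  shows "\<exists>c::real. c > 0 \<and>
    (\<forall>r::real. r > 0 \<longrightarrow> (\<forall>t0::real. t0 > 0 \<longrightarrow>
      (\<exists>j0::real. \<forall>(M::'w measure) (B::real \<Rightarrow> 'w \<Rightarrow> real ^ 'd).
        standard_brownian_motion M B \<longrightarrow>
        (\<forall>t\<ge>t0. \<forall>j\<ge>j0.
          measure M {\<omega> \<in> space M.
            newtonian_capacity (wiener_sausage r t (\<lambda>s. B s \<omega>))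
              \<ge> ennreal (j * t * r ^ (CARD('d) - 4))}
          \<le> exp (- c * j * t)))))"
proof (rule exI[of _ 1], intro conjI allI impI)
  \<comment> \<open>The rate is 1 in every dimension, as all other constants are absorbed in
    \<open>j0\<close>.\<close>
  fix r t0 :: real assume "r > 0" "t0 > 0"
  with assms show "\<exists>j0::real. \<forall>(M::'w measure) (B::real \<Rightarrow> 'w \<Rightarrow> real ^ 'd).
        standard_brownian_motion M B \<longrightarrow>
        (\<forall>t\<ge>t0. \<forall>j\<ge>j0.
          measure M {\<omega> \<in> space M.
            newtonian_capacity (wiener_sausage r t (\<lambda>s. B s \<omega>))
              \<ge> ennreal (j * t * r ^ (CARD('d) - 4))}
          \<le> exp (- 1 * j * t))"
    using wiener_sausage_capacity_tail[where 'a = "real ^ 'd" and 'w = 'w, of r t0] by simp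
qed simp

end
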